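(* Let $N,n$ be positive integers such that $n(N-n)/(N-1)$ is not an integer. Then there is no strictly abelian $\mathrm{ETF}(N,n)$; that is, there is no finite abelian group $G$, strict unitary representation $\rho:G\to U(n)$ and unit vector $v\in\mathbb{C}^n$ such that the reduced configuration $\overline{\rho(G)v}$ consists of $N$ vectors and is an equiangular tight frame of $\mathbb{C}^n$.
   Context: All configurations consist of unit vectors. An $\mathrm{ETF}(N,n)$ is a family of $N$ unit vectors $\varphi_0,\dots,\varphi_{N-1}\in\mathbb{C}^n$ which is a tight frame (i.e. $\sum_j \varphi_j\varphi_j^*=\tfrac{N}{n}I_n$) and is equiangular ($|\langle\varphi_i,\varphi_j\rangle|$ is the same for all $i\neq j$). A strict unitary representation is a group homomorphism $\rho:G\to U(n)$. For a group $G$, a representation $\rho$ and a unit vector $v$, $\rho(G)v$ denotes the family $\{\rho(g)v: g\in G\}$, and $\overline{\rho(G)v}$ denotes a maximal subfamily of $\rho(G)v$ in which no two vectors are proportional (a reduced configuration). *)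

theory Defs
  imports
    "HOL-Algebra.Group"
    "Jordan_Normal_Form.Schur_Decomposition"
begin

definition unitary_group :: "nat \<Rightarrow> complex mat monoid" where
  "unitary_group n =
    \<lparr> carrier = {A \<in> carrier_mat n n. A * mat_adjoint A = 1\<^sub>m n \<and> mat_adjoint A * A = 1\<^sub>m n},
      monoid.mult = (*),
      one = 1\<^sub>m n \<rparr>"

definition is_unit_vec :: "nat \<Rightarrow> complex vec \<Rightarrow> bool" where
  "is_unit_vec n v \<longleftrightarrow> v \<in> carrier_vec n \<and> v \<bullet>c v = 1"

definition proportional :: "complex vec \<Rightarrow> complex vec \<Rightarrow> bool" where
  "proportional v w \<longleftrightarrow> (\<exists>c. c \<noteq> 0 \<and> v = c \<cdot>\<^sub>v w)"

text \<open>The sum of the rank-one matrices \<open>\<phi>\<^sub>i \<phi>\<^sub>i\<^sup>*\<close> is written entrywise, since JNF matrices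
  of unspecified dimension form no additive monoid.\<close>

definition frame_operator :: "nat \<Rightarrow> 'i set \<Rightarrow> ('i \<Rightarrow> complex vec) \<Rightarrow> complex mat" where
  "frame_operator n I \<phi> = mat n n (\<lambda>(a, b). \<Sum>i\<in>I. \<phi> i $ a * cnj (\<phi> i $ b))"

definition is_ETF :: "nat \<Rightarrow> nat \<Rightarrow> 'i set \<Rightarrow> ('i \<Rightarrow> complex vec) \<Rightarrow> bool" where
  "is_ETF N n I \<phi> \<longleftrightarrow>
     finite I \<and> card I = N \<and>
     (\<forall>i\<in>I. is_unit_vec n (\<phi> i)) \<and>
     frame_operator n I \<phi> = (of_nat N / of_nat n) \<cdot>\<^sub>m 1\<^sub>m n \<and>
     (\<exists>c. \<forall>i\<in>I. \<forall>j\<in>I. i \<noteq> j \<longrightarrow> cmod (\<phi> i \<bullet>c \<phi> j) = c)"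

text \<open>A subfamily is given by its index set \<open>R \<subseteq> I\<close>. Equal vectors are proportional, so
  \<open>\<phi>\<close> is injective on the index set of a reduced subfamily.\<close>

definition nonproportional :: "('i \<Rightarrow> complex vec) \<Rightarrow> 'i set \<Rightarrow> bool" where
  "nonproportional \<phi> R \<longleftrightarrow> pairwise (\<lambda>i j. \<not> proportional (\<phi> i) (\<phi> j)) R"

definition is_reduced_subfamily :: "('i \<Rightarrow> complex vec) \<Rightarrow> 'i set \<Rightarrow> 'i set \<Rightarrow> bool" where
  "is_reduced_subfamily \<phi> I R \<longleftrightarrow>
     R \<subseteq> I \<and> nonproportional \<phi> R \<and>
     (\<forall>R'. R \<subseteq> R' \<and> R' \<subseteq> I \<and> nonproportional \<phi> R' \<longrightarrow> R' = R)"

end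

theory Submission
  imports Defs "HOL-Algebra.Multiplicative_Group"
begin

text \<open>
  If the vectors \<open>\<rho>(h) v\<close>, \<open>h \<in> R\<close>, form a tight frame and \<open>\<rho>(g)\<close> commutes with every
  \<open>\<rho>(h)\<close>, then all the numbers \<open>\<langle>\<rho>(g) \<rho>(h) v, \<rho>(h) v\<rangle>\<close> equal \<open>\<langle>\<rho>(g) v, v\<rangle>\<close>, and averaging
  over \<open>h\<close> gives \<open>tr \<rho>(g) = n \<langle>\<rho>(g) v, v\<rangle>\<close>. For \<open>g = j\<^sup>-\<^sup>1 i\<close> with distinct \<open>i, j \<in> R\<close> the Welch
  identity turns this into \<open>\<bar>tr \<rho>(g)\<bar>\<^sup>2 = n (N - n) / (N - 1)\<close>. The left-hand side is a sum of
  roots of unity, hence an algebraic integer; being rational, it is an integer.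
\<close>

section \<open>Integrality of sums of roots of unity\<close>

text \<open>The powers of a primitive \<open>m\<close>-th root of unity span a finitely generated
  additive group that is stable under multiplication by the sum. The sum is therefore an eigenvalue
  of an integer matrix, hence a root of its monic characteristic polynomial.\<close>

lemma algebraic_int_sum_roots_of_unity:
  fixes f :: "'i \<Rightarrow> complex"
  assumes fin: "finite I" and m: "m > 0" and root: "\<And>i. i \<in> I \<Longrightarrow> f i ^ m = 1"
  shows "algebraic_int (\<Sum>i\<in>I. f i)"
proof -
  define \<omega> where "\<omega> = cis (2 * pi / real m)"
  have \<omega>m: "\<omega> ^ m = 1"
    using m by (simp add: \<omega>_def DeMoivre)
  have \<omega>_mod: "\<omega> ^ k = \<omega> ^ (k mod m)" for k
    by (metis \<omega>m div_mult_mod_eq mult.left_neutral power_add power_mult mult.commute power_one)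
  have "\<exists>k. f i = \<omega> ^ k" if "i \<in> I" for i
  proof -
    have "f i \<in> {z. z ^ m = 1}" using root[OF that] by simp
    then obtain k where "f i = cis (2 * pi * real k / real m)"
      using bij_betw_imp_surj_on[OF bij_betw_roots_unity[OF m]] by (metis (no_types, lifting) imageE)
    then have "f i = \<omega> ^ k" by (simp add: \<omega>_def DeMoivre mult.commute)
    then show ?thesis ..
  qed
  then obtain k where k: "\<And>i. i \<in> I \<Longrightarrow> f i = \<omega> ^ k i" by metis
  \<comment> \<open>the matrix of multiplication by the sum with respect to the generators \<open>1, \<omega>, \<dots>, \<omega>\<^sup>m\<^sup>-\<^sup>1\<close>\<close>
  define A :: "int mat" where
    "A = mat m m (\<lambda>(j, l). int (card {i \<in> I. (j + k i) mod m = l}))"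
  define u where "u = vec m (\<lambda>l. \<omega> ^ l)"
  define x where "x = (\<Sum>i\<in>I. f i)"
  have A: "A \<in> carrier_mat m m" by (simp add: A_def)
  let ?A = "map_mat (of_int :: int \<Rightarrow> complex) A"
  have "?A *\<^sub>v u = x \<cdot>\<^sub>v u"
  proof (rule eq_vecI)
    fix j assume "j < dim_vec (x \<cdot>\<^sub>v u)"
    then have j: "j < m" by (simp add: u_def)
    have "(?A *\<^sub>v u) $ j = (\<Sum>l<m. of_nat (card {i \<in> I. (j + k i) mod m = l}) * \<omega> ^ l)"
      using j by (simp add: A_def u_def scalar_prod_def atLeast0LessThan)
    \<comment> \<open>Each cardinality is spread out as a sum over its fibre. The fibres of
      \<open>(j + k i) mod m\<close> partition \<open>I\<close>, so the double sum then collapses to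
      a sum over \<open>I\<close>.\<close>
    also have "\<dots> = (\<Sum>l<m. \<Sum>i\<in>{i \<in> I. (j + k i) mod m = l}. \<omega> ^ ((j + k i) mod m))"
      by (intro sum.cong refl) simp
    also have "\<dots> = (\<Sum>i\<in>I. \<omega> ^ ((j + k i) mod m))"
      using fin m by (intro sum.group) auto
    also have "\<dots> = x * \<omega> ^ j"
      unfolding x_def sum_distrib_right using k
      by (intro sum.cong refl) (simp add: \<omega>_mod[symmetric] power_add mult.commute)
    finally show "(?A *\<^sub>v u) $ j = (x \<cdot>\<^sub>v u) $ j" using j by (simp add: u_def)
  qed (simp add: A_def u_def)
  \<comment> \<open>An eigenvector must be nonzero; the entry of \<open>u\<close> at 0 is the zeroth
    power of the root of unity.\<close>
  moreover have "u $ 0 = 1" using m by (simp add: u_def)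
  then have "u \<noteq> 0\<^sub>v m" using m by (metis index_zero_vec(1) zero_neq_one)
  ultimately have "eigenvalue ?A x"
    unfolding eigenvalue_def eigenvector_def using A by (intro exI[of _ u]) (auto simp: u_def)
  moreover have "char_poly ?A = map_poly of_int (char_poly A)"
    by (rule of_int_hom.char_poly_hom[OF A])
  ultimately have "poly (map_poly of_int (char_poly A)) x = 0"
    using eigenvalue_root_char_poly[of ?A m x] A by auto
  moreover have "lead_coeff (char_poly A) = 1"
    using degree_monic_char_poly[OF A] by auto
  ultimately show ?thesis
    unfolding algebraic_int_altdef_ipoly x_def by blast
qed

section \<open>Traces of matrices of finite order\<close>

lemma trace_similar_mat:
  fixes A B :: "'a :: comm_ring_1 mat"
  assumes A: "A \<in> carrier_mat n n" and sim: "similar_mat A B"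
  shows "(\<Sum>a<n. A $$ (a, a)) = (\<Sum>a<n. B $$ (a, a))"
proof -
  have comm: "(\<Sum>a<n. (X * Y) $$ (a, a)) = (\<Sum>a<n. (Y * X) $$ (a, a))"
    if "X \<in> carrier_mat n n" "Y \<in> carrier_mat n n" for X Y :: "'a mat"
  proof -
    have "(\<Sum>a<n. (X * Y) $$ (a, a)) = (\<Sum>a<n. \<Sum>b<n. X $$ (a, b) * Y $$ (b, a))"
      using that by (auto simp: scalar_prod_def atLeast0LessThan intro!: sum.cong)
    also have "\<dots> = (\<Sum>b<n. \<Sum>a<n. Y $$ (b, a) * X $$ (a, b))"
      by (subst sum.swap) (simp add: mult.commute)
    also have "\<dots> = (\<Sum>a<n. (Y * X) $$ (a, a))"
      using that by (auto simp: scalar_prod_def atLeast0LessThan intro!: sum.cong)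
    finally show ?thesis .
  qed
  obtain P Q where "similar_mat_wit A B P Q" using sim by (auto simp: similar_mat_def)
  note w = similar_mat_witD2[OF A this]
  \<comment> \<open>Here A = P B Q with Q P = 1, so moving Q to the front under the trace leaves
    B.\<close>
  have "(\<Sum>a<n. A $$ (a, a)) = (\<Sum>a<n. (Q * (P * B)) $$ (a, a))"
    unfolding w(3) using w by (intro comm) auto
  also have "Q * (P * B) = B"
    using w by (simp add: assoc_mult_mat[of Q n n P n B n, symmetric])
  finally show ?thesis .
qed

text \<open>Schur triangularisation puts the eigenvalues on the diagonal, and each of them is an
  \<open>m\<close>-th root of unity because \<open>A\<close> acts on an eigenvector as a scalar
  while its \<open>m\<close>-th power is the identity. Diagonalisability is thus avoided.\<close>

lemma trace_eq_sum_roots_of_unity: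
  fixes A :: "complex mat"
  assumes A: "A \<in> carrier_mat n n" and pow: "A ^\<^sub>m m = 1\<^sub>m n"
  obtains e where "(\<Sum>a<n. A $$ (a, a)) = (\<Sum>a<n. e a)" "\<And>a. a < n \<Longrightarrow> e a ^ m = 1"
proof -
  obtain es where es: "char_poly A = (\<Prod>a\<leftarrow>es. [:- a, 1:])"
    using char_poly_factorized[OF A] by blast
  obtain B where B: "B \<in> carrier_mat n n" "upper_triangular B" "similar_mat A B"
    using schur_decomposition_exists[OF A es] by blast
  have root: "B $$ (a, a) ^ m = 1" if a: "a < n" for a
  proof -
    let ?e = "B $$ (a, a)"
    have "char_poly A = (\<Prod>b\<leftarrow>diag_mat B. [:- b, 1:])"
      using char_poly_similar[OF B(3)] char_poly_upper_triangular[OF B(1,2)] by simp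
    then have "poly (char_poly A) ?e = 0"
      using B(1) a by (auto simp: poly_prod_list prod_list_zero_iff diag_mat_def)
    then obtain w where w: "eigenvector A w ?e"
      using eigenvalue_root_char_poly[OF A] by (auto simp: eigenvalue_def)
    then have wc: "w \<in> carrier_vec n" "w \<noteq> 0\<^sub>v n" using A by (auto simp: eigenvector_def)
    have "w = ?e ^ m \<cdot>\<^sub>v w"
      using eigenvector_pow[OF A w, of m] pow wc by simp
    moreover obtain i where i: "i < n" "w $ i \<noteq> 0"
      using wc by (metis carrier_vecD eq_vecI index_zero_vec)
    ultimately have "w $ i = ?e ^ m * w $ i"
      using wc by (metis carrier_vecD index_smult_vec(1))
    then show ?thesis using i by simp
  qed
  show thesis
    by (rule that[OF trace_similar_mat[OF A B(3)] root])
qed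

text \<open>The squared modulus expands into a double sum of products of an eigenvalue with a
  conjugated eigenvalue, and these products are again \<open>m\<close>-th roots of unity.\<close>

lemma algebraic_int_cmod_trace_square:
  fixes A :: "complex mat"
  assumes A: "A \<in> carrier_mat n n" and pow: "A ^\<^sub>m m = 1\<^sub>m n" and m: "m > 0"
  shows "algebraic_int (complex_of_real ((cmod (\<Sum>a<n. A $$ (a, a)))\<^sup>2))"
proof -
  obtain e where tr: "(\<Sum>a<n. A $$ (a, a)) = (\<Sum>a<n. e a)" and e: "\<And>a. a < n \<Longrightarrow> e a ^ m = 1"
    using trace_eq_sum_roots_of_unity[OF A pow] by blast
  have "complex_of_real ((cmod (\<Sum>a<n. A $$ (a, a)))\<^sup>2) = (\<Sum>a<n. e a) * (\<Sum>b<n. cnj (e b))"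
    unfolding tr complex_norm_square by simp
  also have "\<dots> = (\<Sum>(a, b)\<in>{..<n} \<times> {..<n}. e a * cnj (e b))"
    by (simp add: sum_product sum.cartesian_product)
  finally show ?thesis
    using e m by (auto intro!: algebraic_int_sum_roots_of_unity[where m = m]
        simp: power_mult_distrib simp flip: complex_cnj_power)
qed

section \<open>Inner products, unitary matrices and tight frames\<close>

lemma cscalar_prod_eq_sum:
  fixes x y :: "complex vec"
  assumes "y \<in> carrier_vec n"
  shows "x \<bullet>c y = (\<Sum>a<n. x $ a * cnj (y $ a))"
  using assms by (auto simp: scalar_prod_def atLeast0LessThan)

lemma unitary_group_cscalar_prod:
  assumes U: "U \<in> carrier (unitary_group n)"
    and x: "x \<in> carrier_vec n" and y: "y \<in> carrier_vec n"
  shows "(U *\<^sub>v x) \<bullet>c (U *\<^sub>v y) = x \<bullet>c y"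
proof -
  have Uc: "U \<in> carrier_mat n n" and UU: "mat_adjoint U * U = 1\<^sub>m n"
    using U by (auto simp: unitary_group_def)
  have adj: "mat_adjoint U $$ (b, a) = cnj (U $$ (a, b))" if "a < n" "b < n" for a b
    using that Uc by (simp add: mat_adjoint_def mat_of_rows_index)
  \<comment> \<open>The columns of \<open>U\<close> are orthonormal; this reduces the triple sum
    below to its diagonal.\<close>
  have orth: "(\<Sum>a<n. cnj (U $$ (a, b)) * U $$ (a, c)) = (if b = c then 1 else 0)"
    if "b < n" "c < n" for b c
  proof -
    have adjc: "mat_adjoint U \<in> carrier_mat n n" using Uc by (auto simp: mat_adjoint_def)
    have "(if b = c then 1 else 0) = (mat_adjoint U * U) $$ (b, c)"
      using that by (simp add: UU)
    also have "\<dots> = (\<Sum>a<n. mat_adjoint U $$ (b, a) * U $$ (a, c))"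
      using that Uc adjc by (auto simp: scalar_prod_def atLeast0LessThan)
    finally show ?thesis using that by (simp add: adj)
  qed
  have Ux: "(U *\<^sub>v z) $ a = (\<Sum>b<n. U $$ (a, b) * z $ b)"
    if "a < n" "z \<in> carrier_vec n" for a and z :: "complex vec"
    using that Uc by (auto simp: scalar_prod_def atLeast0LessThan)
  have "(U *\<^sub>v x) \<bullet>c (U *\<^sub>v y)
      = (\<Sum>a<n. \<Sum>c<n. \<Sum>b<n. U $$ (a, c) * x $ c * (cnj (U $$ (a, b)) * cnj (y $ b)))"
    using Uc x y by (subst cscalar_prod_eq_sum[of _ n]) (auto simp: Ux sum_product
        simp del: index_mult_mat_vec)
  also have "\<dots> = (\<Sum>c<n. \<Sum>b<n. \<Sum>a<n. U $$ (a, c) * x $ c * (cnj (U $$ (a, b)) * cnj (y $ b)))"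
    by (rule trans[OF sum.swap], rule sum.cong[OF refl], rule sum.swap)
  also have "\<dots> = (\<Sum>c<n. \<Sum>b<n. x $ c * cnj (y $ b) * (\<Sum>a<n. cnj (U $$ (a, b)) * U $$ (a, c)))"
    by (simp add: sum_distrib_left mult_ac)
  also have "\<dots> = (\<Sum>c<n. \<Sum>b<n. if b = c then x $ c * cnj (y $ b) else 0)"
    by (intro sum.cong refl) (simp add: orth)
  also have "\<dots> = x \<bullet>c y"
    using y by (simp add: cscalar_prod_eq_sum)
  finally show ?thesis .
qed

text \<open>Summing over the frame first turns each product of coordinates into an entry of the
  frame operator, which is scalar. The coefficients \<open>P\<close> are left arbitrary to serve two
  cases: the entries of a matrix give the trace formula, those of x x* give Parseval.\<close>

lemma tight_frame_sum_quadratic_form: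
  fixes P :: "nat \<Rightarrow> nat \<Rightarrow> complex"
  assumes tight: "frame_operator n I \<phi> = c \<cdot>\<^sub>m 1\<^sub>m n"
  shows "(\<Sum>i\<in>I. \<Sum>a<n. \<Sum>b<n. P a b * \<phi> i $ b * cnj (\<phi> i $ a)) = c * (\<Sum>a<n. P a a)"
proof -
  have entry: "(\<Sum>i\<in>I. \<phi> i $ b * cnj (\<phi> i $ a)) = (if b = a then c else 0)"
    if "a < n" "b < n" for a b
  proof -
    have "(\<Sum>i\<in>I. \<phi> i $ b * cnj (\<phi> i $ a)) = frame_operator n I \<phi> $$ (b, a)"
      using that by (simp add: frame_operator_def)
    then show ?thesis using that by (simp add: tight)
  qed
  have "(\<Sum>i\<in>I. \<Sum>a<n. \<Sum>b<n. P a b * \<phi> i $ b * cnj (\<phi> i $ a))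
      = (\<Sum>a<n. \<Sum>b<n. \<Sum>i\<in>I. P a b * \<phi> i $ b * cnj (\<phi> i $ a))"
    by (rule trans[OF sum.swap], rule sum.cong[OF refl], rule sum.swap)
  also have "\<dots> = (\<Sum>a<n. \<Sum>b<n. P a b * (\<Sum>i\<in>I. \<phi> i $ b * cnj (\<phi> i $ a)))"
    by (simp add: sum_distrib_left mult.assoc)
  also have "\<dots> = (\<Sum>a<n. \<Sum>b<n. if b = a then c * P a b else 0)"
    by (intro sum.cong refl) (simp add: entry mult.commute)
  finally show ?thesis by (simp add: sum_distrib_left)
qed

lemma tight_frame_sum_cscalar_prod:
  assumes tight: "frame_operator n I \<phi> = c \<cdot>\<^sub>m 1\<^sub>m n"
    and A: "A \<in> carrier_mat n n" and \<phi>: "\<And>i. i \<in> I \<Longrightarrow> \<phi> i \<in> carrier_vec n"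
  shows "(\<Sum>i\<in>I. (A *\<^sub>v \<phi> i) \<bullet>c \<phi> i) = c * (\<Sum>a<n. A $$ (a, a))"
proof -
  have "(A *\<^sub>v \<phi> i) \<bullet>c \<phi> i = (\<Sum>a<n. \<Sum>b<n. A $$ (a, b) * \<phi> i $ b * cnj (\<phi> i $ a))"
    if "i \<in> I" for i
    using A \<phi>[OF that] by (auto simp: cscalar_prod_eq_sum[of _ n] scalar_prod_def
        atLeast0LessThan sum_distrib_right intro!: sum.cong)
  then show ?thesis
    using tight_frame_sum_quadratic_form[OF tight, of "\<lambda>a b. A $$ (a, b)"] by simp
qed

lemma tight_frame_parseval:
  assumes tight: "frame_operator n I \<phi> = c \<cdot>\<^sub>m 1\<^sub>m n"
    and x: "x \<in> carrier_vec n" and \<phi>: "\<And>i. i \<in> I \<Longrightarrow> \<phi> i \<in> carrier_vec n"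
  shows "(\<Sum>i\<in>I. complex_of_real ((cmod (\<phi> i \<bullet>c x))\<^sup>2)) = c * (x \<bullet>c x)"
proof -
  have "complex_of_real ((cmod (\<phi> i \<bullet>c x))\<^sup>2)
      = (\<Sum>a<n. \<Sum>b<n. x $ a * cnj (x $ b) * \<phi> i $ b * cnj (\<phi> i $ a))" if "i \<in> I" for i
  proof -
    have "complex_of_real ((cmod (\<phi> i \<bullet>c x))\<^sup>2)
        = (\<Sum>a<n. cnj (\<phi> i $ a) * x $ a) * (\<Sum>b<n. \<phi> i $ b * cnj (x $ b))"
      unfolding complex_norm_square cscalar_prod_eq_sum[OF x] by (simp add: mult.commute)
    then show ?thesis by (simp add: sum_product mult_ac)
  qed
  then show ?thesis
    using tight_frame_sum_quadratic_form[OF tight, of "\<lambda>a b. x $ a * cnj (x $ b)"] x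
    by (simp add: cscalar_prod_eq_sum)
qed

text \<open>In Parseval for the frame vector with index \<open>j\<close>, the term k = j contributes
  1 and the other N - 1 terms share the common squared modulus; the total is N/n.\<close>

lemma ETF_welch:
  assumes etf: "is_ETF N n I \<phi>" and ij: "i \<in> I" "j \<in> I" "i \<noteq> j"
  shows "(cmod (\<phi> i \<bullet>c \<phi> j))\<^sup>2 * (real N - 1) = real N / real n - 1"
proof -
  have fin: "finite I" and card: "card I = N"
    and tight: "frame_operator n I \<phi> = (of_nat N / of_nat n) \<cdot>\<^sub>m 1\<^sub>m n"
    and unit: "\<And>k. k \<in> I \<Longrightarrow> \<phi> k \<in> carrier_vec n" "\<And>k. k \<in> I \<Longrightarrow> \<phi> k \<bullet>c \<phi> k = 1"
    using etf by (auto simp: is_ETF_def is_unit_vec_def)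
  obtain c where c: "\<And>k l. k \<in> I \<Longrightarrow> l \<in> I \<Longrightarrow> k \<noteq> l \<Longrightarrow> cmod (\<phi> k \<bullet>c \<phi> l) = c"
    using etf by (auto simp: is_ETF_def)
  have "complex_of_real (\<Sum>k\<in>I. (cmod (\<phi> k \<bullet>c \<phi> j))\<^sup>2) = complex_of_real (real N / real n)"
    using tight_frame_parseval[OF tight unit(1)[OF ij(2)] unit(1)] unit(2)[OF ij(2)] by simp
  then have "real N / real n = (\<Sum>k\<in>I. (cmod (\<phi> k \<bullet>c \<phi> j))\<^sup>2)"
    by (simp only: of_real_eq_iff)
  also have "\<dots> = (cmod (\<phi> j \<bullet>c \<phi> j))\<^sup>2 + (\<Sum>k\<in>I - {j}. (cmod (\<phi> k \<bullet>c \<phi> j))\<^sup>2)"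
    by (rule sum.remove[OF fin ij(2)])
  also have "\<dots> = 1 + (\<Sum>k\<in>I - {j}. c\<^sup>2)"
    using unit ij c by (auto intro!: sum.cong)
  also have "\<dots> = 1 + real (card (I - {j})) * c\<^sup>2"
    by simp
  also have "real (card (I - {j})) = real N - 1"
    using card_Suc_Diff1[OF fin ij(2)] card by linarith
  finally show ?thesis using c[OF ij] by (simp add: mult.commute)
qed

section \<open>Traces of the representation and the contradiction with non-integrality\<close>

theorem theorem3p2:
  fixes N n :: nat
  assumes "N > 0" and "n > 0"
    and "real n * (real N - real n) / (real N - 1) \<notin> \<int>"
  shows "\<not> (\<exists>(G :: 'g monoid) \<rho> v R.
            comm_group G \<and> finite (carrier G) \<and>
            \<rho> \<in> hom G (unitary_group n) \<and>
            is_unit_vec n v \<and>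
            is_reduced_subfamily (\<lambda>g. \<rho> g *\<^sub>v v) (carrier G) R \<and>
            is_ETF N n R (\<lambda>g. \<rho> g *\<^sub>v v))"
proof
  assume "\<exists>(G :: 'g monoid) \<rho> v R.
            comm_group G \<and> finite (carrier G) \<and>
            \<rho> \<in> hom G (unitary_group n) \<and>
            is_unit_vec n v \<and>
            is_reduced_subfamily (\<lambda>g. \<rho> g *\<^sub>v v) (carrier G) R \<and>
            is_ETF N n R (\<lambda>g. \<rho> g *\<^sub>v v)"
  then obtain G :: "'g monoid" and \<rho> v R where
    G: "comm_group G" and finG: "finite (carrier G)" and hom: "\<rho> \<in> hom G (unitary_group n)"
    and v: "is_unit_vec n v" and red: "is_reduced_subfamily (\<lambda>g. \<rho> g *\<^sub>v v) (carrier G) R"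
    and etf: "is_ETF N n R (\<lambda>g. \<rho> g *\<^sub>v v)"
    by blast
  interpret comm_group G by (rule G)
  have \<rho>U: "\<rho> g \<in> carrier (unitary_group n)" if "g \<in> carrier G" for g
    using hom that by (auto simp: hom_def)
  then have \<rho>c: "\<rho> g \<in> carrier_mat n n" if "g \<in> carrier G" for g
    using that by (auto simp: unitary_group_def)
  have \<rho>mult: "\<rho> (g \<otimes>\<^bsub>G\<^esub> h) = \<rho> g * \<rho> h" if "g \<in> carrier G" "h \<in> carrier G" for g h
    using hom that by (auto simp: hom_def unitary_group_def)
  have vc: "v \<in> carrier_vec n" using v by (simp add: is_unit_vec_def)
  have RG: "R \<subseteq> carrier G" using red by (simp add: is_reduced_subfamily_def)
  have cardR: "card R = N"
    and tight: "frame_operator n R (\<lambda>g. \<rho> g *\<^sub>v v) = (of_nat N / of_nat n) \<cdot>\<^sub>m 1\<^sub>m n"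
    using etf by (auto simp: is_ETF_def)
  \<comment> \<open>\<open>x / 0 = 0\<close> is an integer, so the hypothesis excludes \<open>N = 1\<close>\<close>
  have "N \<noteq> 1" using assms(3) by auto
  then have "2 \<le> card R" using assms(1) cardR by simp
  then obtain i j where ij: "i \<in> R" "j \<in> R" "i \<noteq> j"
    by (metis card_2_iff' obtain_subset_with_card_n subsetD)
  then have ijG: "i \<in> carrier G" "j \<in> carrier G" using RG by auto
  \<comment> \<open>With this choice the vector of \<open>i\<close> is the image under the unitary
    \<rho>(j) of \<rho>(g) v, so the inner product of the two frame vectors becomes that of
    \<rho>(g) v with v.\<close>
  define g where "g = inv\<^bsub>G\<^esub> j \<otimes>\<^bsub>G\<^esub> i"
  have g: "g \<in> carrier G" using ijG by (simp add: g_def)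
  have jg: "j \<otimes>\<^bsub>G\<^esub> g = i" using ijG by (simp add: g_def m_assoc[symmetric])
  \<comment> \<open>Membership in \<open>hom\<close> records multiplicativity only. The image of the
    identity is idempotent, and multiplying by its adjoint cancels one factor.\<close>
  have \<rho>one: "\<rho> \<one>\<^bsub>G\<^esub> = 1\<^sub>m n"
  proof -
    let ?E = "\<rho> \<one>\<^bsub>G\<^esub>" and ?F = "mat_adjoint (\<rho> \<one>\<^bsub>G\<^esub>)"
    have E: "?E \<in> carrier_mat n n" "?F * ?E = 1\<^sub>m n"
      using \<rho>U[of "\<one>\<^bsub>G\<^esub>"] by (auto simp: unitary_group_def)
    then have F: "?F \<in> carrier_mat n n" by (auto simp: mat_adjoint_def)
    have "?E = (?F * ?E) * ?E" using E by simp
    also have "\<dots> = ?F * (?E * ?E)" using E F by (intro assoc_mult_mat) auto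
    also have "?E * ?E = ?E" using \<rho>mult[of "\<one>\<^bsub>G\<^esub>" "\<one>\<^bsub>G\<^esub>"] by simp
    finally show ?thesis using E by simp
  qed
  have "\<rho> (g [^]\<^bsub>G\<^esub> k) = \<rho> g ^\<^sub>m k" for k :: nat
    using g \<rho>c[OF g] by (induction k) (auto simp: \<rho>one \<rho>mult)
  \<comment> \<open>Lagrange: the group order serves as the exponent \<open>m\<close> for the roots
    of unity.\<close>
  then have pow: "\<rho> g ^\<^sub>m Coset.order G = 1\<^sub>m n"
    using pow_order_eq_1[OF g] \<rho>one by metis
  define t where "t = (\<Sum>a<n. \<rho> g $$ (a, a))"
  \<comment> \<open>Commutativity of the group enters here: \<rho>(g) is moved past \<rho>(h), after
    which the unitary \<rho>(h) drops out of the inner product.\<close>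
  have "(\<rho> g *\<^sub>v (\<rho> h *\<^sub>v v)) \<bullet>c (\<rho> h *\<^sub>v v) = (\<rho> g *\<^sub>v v) \<bullet>c v" if "h \<in> R" for h
  proof -
    have h: "h \<in> carrier G" using that RG by auto
    have "\<rho> g *\<^sub>v (\<rho> h *\<^sub>v v) = \<rho> (g \<otimes>\<^bsub>G\<^esub> h) *\<^sub>v v"
      using \<rho>mult[OF g h] \<rho>c[OF g] \<rho>c[OF h] vc by simp
    also have "\<dots> = \<rho> h *\<^sub>v (\<rho> g *\<^sub>v v)"
      using \<rho>mult[OF h g] \<rho>c[OF g] \<rho>c[OF h] vc m_comm[OF g h] by simp
    finally show ?thesis
      using unitary_group_cscalar_prod[OF \<rho>U[OF h]] \<rho>c[OF g] vc by simp
  qed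
  \<comment> \<open>The N equal terms are summed and compared with the trace formula for tight
    frames; cancelling N then determines the trace \<open>t\<close>.\<close>
  then have "of_nat N * ((\<rho> g *\<^sub>v v) \<bullet>c v)
      = (\<Sum>h\<in>R. (\<rho> g *\<^sub>v (\<rho> h *\<^sub>v v)) \<bullet>c (\<rho> h *\<^sub>v v))"
    using cardR by simp
  also have "\<dots> = of_nat N / of_nat n * t"
    unfolding t_def using RG \<rho>c vc
    by (intro tight_frame_sum_cscalar_prod[OF tight \<rho>c[OF g]]) (auto intro!: mult_mat_vec_carrier)
  finally have t: "t = of_nat n * ((\<rho> g *\<^sub>v v) \<bullet>c v)"
    using assms by (simp add: field_simps)
  have "(\<rho> i *\<^sub>v v) \<bullet>c (\<rho> j *\<^sub>v v) = (\<rho> j *\<^sub>v (\<rho> g *\<^sub>v v)) \<bullet>c (\<rho> j *\<^sub>v v)"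
    using \<rho>mult[OF ijG(2) g] jg \<rho>c[OF g] \<rho>c[OF ijG(2)] vc by simp
  also have "\<dots> = (\<rho> g *\<^sub>v v) \<bullet>c v"
    using unitary_group_cscalar_prod[OF \<rho>U[OF ijG(2)]] \<rho>c[OF g] vc by simp
  finally have "(cmod ((\<rho> g *\<^sub>v v) \<bullet>c v))\<^sup>2 * (real N - 1) = real N / real n - 1"
    using ETF_welch[OF etf ij] by simp
  then have "(cmod t)\<^sup>2 * (real N - 1) = (real n)\<^sup>2 * (real N / real n - 1)"
    by (simp add: t norm_mult power_mult_distrib)
  also have "\<dots> = real n * (real N - real n)"
    using assms(2) by (simp add: field_simps power2_eq_square)
  finally have "(cmod t)\<^sup>2 = real n * (real N - real n) / (real N - 1)"
    using \<open>N \<noteq> 1\<close> by (simp add: eq_divide_eq)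
  moreover have "algebraic_int (complex_of_real ((cmod t)\<^sup>2))"
    unfolding t_def using finG
    by (intro algebraic_int_cmod_trace_square[OF \<rho>c[OF g] pow]) (simp add: order_gt_0_iff_finite)
  ultimately have "algebraic_int (complex_of_real (real n * (real N - real n) / (real N - 1)))"
    by simp
  \<comment> \<open>A rational algebraic integer is an ordinary integer, which contradicts the
    hypothesis on n(N - n)/(N - 1).\<close>
  moreover have "complex_of_real (real n * (real N - real n) / (real N - 1)) \<in> \<rat>"
    by (simp add: Rats_mult Rats_divide Rats_diff)
  ultimately obtain z where z: "complex_of_real (real n * (real N - real n) / (real N - 1)) = of_int z"
    using rational_algebraic_int_is_int Ints_cases by blast
  have "complex_of_real (real n * (real N - real n) / (real N - 1)) = complex_of_real (of_int z)"
    unfolding z by simp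
  then have "real n * (real N - real n) / (real N - 1) = of_int z"
    by (simp only: of_real_eq_iff)
  then show False
    using assms(3) by simp
qed

end
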